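(* Let $H$ be a real Hilbert space and let $\mathcal{E}: H \to [0,\infty]$ be a symmetric, convex, lower semicontinuous functional. Let $(\mathfrak{D}, \|\cdot\|_{\mathfrak{D}})$ be the energy space of $\mathcal{E}$ with its energy norm. Then $(\mathfrak{D},\|\cdot\|_{\mathfrak{D}})$ is a Banach space. In addition, the embedding $i:\mathfrak{D}\to H$ is continuous, and $\|\cdot\|_{\mathfrak{D}}: H\to[0,\infty]$ is lower semicontinuous on $H$.
   Context: $\mathcal{E}:H\to[0,\infty]$ is called symmetric if $\mathcal{E}(0)=0$ and $\mathcal{E}(-x)=\mathcal{E}(x)$ for all $x\in H$. Put $\mathcal{E}_1(x)=\|x\|_H^2+\mathcal{E}(x)$ and define, for $x\in H$, $\|x\|_{\mathfrak{D}}=\inf\{\lambda>0 \mid \mathcal{E}_1(x/\lambda)\le 1\}\in[0,\infty]$ (with $\inf\emptyset=\infty$). The energy space is $\mathfrak{D}=\{x\in H \mid \exists\,\lambda>0:\ \mathcal{E}_1(\lambda x)<\infty\}=\{x\in H\mid \|x\|_{\mathfrak{D}}<\infty\}$. *)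

theory Defs
  imports "HOL-Analysis.Analysis"
begin

section \<open>Functionals with values in the extended half-line\<close>

definition symmetric_functional :: "('a::real_vector \<Rightarrow> ennreal) \<Rightarrow> bool" where
  "symmetric_functional F \<longleftrightarrow> F 0 = 0 \<and> (\<forall>x. F (- x) = F x)"

text \<open>The convention \<open>0 * \<infinity> = 0\<close> of \<^typ>\<open>ennreal\<close> makes the inequality trivial at \<open>t = 0\<close>
  and \<open>t = 1\<close>. The library's \<open>convex_on\<close> is for real-valued functions only.\<close>

definition convex_functional :: "('a::real_vector \<Rightarrow> ennreal) \<Rightarrow> bool" where
  "convex_functional F \<longleftrightarrow>
     (\<forall>x y t. 0 \<le> t \<and> t \<le> 1 \<longrightarrow>
        F ((1 - t) *\<^sub>R x + t *\<^sub>R y) \<le> ennreal (1 - t) * F x + ennreal t * F y)"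

text \<open>On a metric space sequences suffice.\<close>

definition lower_semicontinuous :: "('a::metric_space \<Rightarrow> ennreal) \<Rightarrow> bool" where
  "lower_semicontinuous F \<longleftrightarrow>
     (\<forall>x X. X \<longlonglongrightarrow> x \<longrightarrow> F x \<le> liminf (\<lambda>n. F (X n)))"


section \<open>Norms on a linear subspace\<close>

text \<open>The function \<open>N\<close> may take the value \<open>\<infinity>\<close> outside of \<open>V\<close>.\<close>

definition norm_on :: "'a::real_vector set \<Rightarrow> ('a \<Rightarrow> ennreal) \<Rightarrow> bool" where
  "norm_on V N \<longleftrightarrow> subspace V \<and>
     (\<forall>x\<in>V. N x < \<infinity>) \<and>
     (\<forall>x\<in>V. N x = 0 \<longrightarrow> x = 0) \<and>
     (\<forall>x\<in>V. \<forall>a. N (a *\<^sub>R x) = ennreal \<bar>a\<bar> * N x) \<and>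
     (\<forall>x\<in>V. \<forall>y\<in>V. N (x + y) \<le> N x + N y)"

definition norm_dist :: "('a::real_vector \<Rightarrow> ennreal) \<Rightarrow> 'a \<Rightarrow> 'a \<Rightarrow> real" where
  "norm_dist N x y = enn2real (N (x - y))"

definition banach_space_on :: "'a::real_vector set \<Rightarrow> ('a \<Rightarrow> ennreal) \<Rightarrow> bool" where
  "banach_space_on V N \<longleftrightarrow> norm_on V N \<and> Metric_space.mcomplete V (norm_dist N)"

lemma norm_on_norm_dist_metric:
  assumes "norm_on V N" "\<And>x. N (- x) = N x"
  shows "Metric_space V (norm_dist N)"
proof
  have sub: "subspace V" and fin: "\<And>x. x \<in> V \<Longrightarrow> N x < \<infinity>"
    and tri: "\<And>x y. x \<in> V \<Longrightarrow> y \<in> V \<Longrightarrow> N (x + y) \<le> N x + N y"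
    and def: "\<And>x. x \<in> V \<Longrightarrow> N x = 0 \<Longrightarrow> x = 0"
    and hom: "\<And>x a. x \<in> V \<Longrightarrow> N (a *\<^sub>R x) = ennreal \<bar>a\<bar> * N x"
    using assms(1) by (auto simp: norm_on_def)
  fix x y z
  show "0 \<le> norm_dist N x y" by (simp add: norm_dist_def)
  show "norm_dist N x y = norm_dist N y x"
    using assms(2)[of "x - y"] by (simp add: norm_dist_def)
  assume x: "x \<in> V" and y: "y \<in> V"
  have xy: "x - y \<in> V" using sub x y by (rule subspace_diff)
  have "N 0 = 0" using hom[OF x, of 0] by simp
  then show "norm_dist N x y = 0 \<longleftrightarrow> x = y"
    using def[OF xy] fin[OF xy] by (auto simp: norm_dist_def enn2real_eq_0_iff)
  assume z: "z \<in> V"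
  have yz: "y - z \<in> V" using sub y z by (rule subspace_diff)
  have "N (x - z) \<le> N (x - y) + N (y - z)" using tri[OF xy yz] by simp
  then have "enn2real (N (x - z)) \<le> enn2real (N (x - y) + N (y - z))"
    using fin[OF xy] fin[OF yz] by (intro enn2real_mono) auto
  also have "\<dots> = enn2real (N (x - y)) + enn2real (N (y - z))"
    using fin[OF xy] fin[OF yz] by (intro enn2real_plus) auto
  finally show "norm_dist N x z \<le> norm_dist N x y + norm_dist N y z"
    by (simp add: norm_dist_def)
qed


section \<open>Energy space and energy norm\<close>

definition energy1 :: "('a::real_inner \<Rightarrow> ennreal) \<Rightarrow> 'a \<Rightarrow> ennreal" where
  "energy1 F x = ennreal ((norm x)\<^sup>2) + F x"

text \<open>In \<^typ>\<open>ennreal\<close>, \<open>Inf {} = \<infinity>\<close>.\<close>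

definition energy_norm :: "('a::real_inner \<Rightarrow> ennreal) \<Rightarrow> 'a \<Rightarrow> ennreal" where
  "energy_norm F x = Inf {ennreal l | l::real. l > 0 \<and> energy1 F (x /\<^sub>R l) \<le> 1}"

definition energy_space :: "('a::real_inner \<Rightarrow> ennreal) \<Rightarrow> 'a set" where
  "energy_space F = {x. \<exists>l::real>0. energy1 F (l *\<^sub>R x) < \<infinity>}"

lemma energy_space_eq_finite_norm:
  fixes F :: "'a::real_inner \<Rightarrow> ennreal"
  assumes "symmetric_functional F" "convex_functional F"
  shows "energy_space F = {x. energy_norm F x < \<infinity>}"
proof (intro set_eqI iffI)
  fix x assume "x \<in> energy_space F"
  then obtain l :: real where l: "l > 0" "energy1 F (l *\<^sub>R x) < \<infinity>"
    by (auto simp: energy_space_def)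
  define c where "c = enn2real (energy1 F (l *\<^sub>R x))"
  have c: "energy1 F (l *\<^sub>R x) = ennreal c" "c \<ge> 0"
    using l(2) by (auto simp: c_def)
  define t where "t = 1 / (1 + c)"
  have t: "0 < t" "t \<le> 1" "t * c \<le> 1" using c(2) by (auto simp: t_def field_simps)
  have F: "F (t *\<^sub>R l *\<^sub>R x) \<le> ennreal t * F (l *\<^sub>R x)"
  proof -
    have "0 \<le> t \<and> t \<le> 1 \<longrightarrow> F ((1 - t) *\<^sub>R 0 + t *\<^sub>R l *\<^sub>R x)
        \<le> ennreal (1 - t) * F 0 + ennreal t * F (l *\<^sub>R x)"
      using assms(2) unfolding convex_functional_def by blast
    then show ?thesis using t assms(1) by (simp add: symmetric_functional_def)
  qed
  have n: "(norm (t *\<^sub>R l *\<^sub>R x))\<^sup>2 \<le> t * (norm (l *\<^sub>R x))\<^sup>2"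
  proof -
    have "t\<^sup>2 \<le> t" using t by (simp add: power2_eq_square mult_left_le)
    then have "t\<^sup>2 * (norm (l *\<^sub>R x))\<^sup>2 \<le> t * (norm (l *\<^sub>R x))\<^sup>2"
      by (intro mult_right_mono) auto
    then show ?thesis using t by (simp add: power_mult_distrib)
  qed
  have "energy1 F (t *\<^sub>R l *\<^sub>R x) \<le> ennreal t * energy1 F (l *\<^sub>R x)"
    unfolding energy1_def distrib_left
    using n F t by (intro add_mono) (auto simp: ennreal_mult[symmetric] intro!: ennreal_leI)
  also have "\<dots> \<le> 1"
    using c t by (simp add: ennreal_mult[symmetric] ennreal_le_1)
  finally have "energy1 F (x /\<^sub>R (1 / (t * l))) \<le> 1"
    by (simp add: field_simps)
  then have "ennreal (1 / (t * l)) \<in> {ennreal l | l::real. l > 0 \<and> energy1 F (x /\<^sub>R l) \<le> 1}"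
    using t l by (intro CollectI exI[of _ "1 / (t * l)"]) auto
  then have "energy_norm F x \<le> ennreal (1 / (t * l))"
    unfolding energy_norm_def by (rule Inf_lower)
  then show "x \<in> {x. energy_norm F x < \<infinity>}"
    using le_less_trans ennreal_less_top by fastforce
next
  fix x assume "x \<in> {x. energy_norm F x < \<infinity>}"
  then obtain l :: real where "l > 0" "energy1 F (x /\<^sub>R l) \<le> 1"
    by (auto simp: energy_norm_def Inf_less_iff)
  then show "x \<in> energy_space F"
    unfolding energy_space_def
    by (auto intro!: exI[of _ "inverse l"] intro: le_less_trans)
qed

end

theory Submission
  imports Defs
begin

text \<open>The point is that the infimum defining the energy norm is attained: by lower
  semicontinuity, for \<open>l > 0\<close> the bound \<open>\<parallel>x\<parallel> \<le> l\<close> holds if and only if \<open>\<E>\<^sub>1 (x / l) \<le> 1\<close>. The norm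
  axioms and lower semicontinuity of the norm are then inherited from the convex functional
  \<open>\<E>\<^sub>1\<close>, and \<open>\<E>\<^sub>1 (x / l) \<le> 1\<close> forces the Hilbert norm of \<open>x\<close> to be at most \<open>l\<close>. An energy-Cauchy
  sequence therefore converges in the Hilbert space, and lower semicontinuity of the energy norm
  upgrades this to convergence in energy.\<close>

text \<open>Strict lower bounds persist along the sequence. This form suits
  \<open>energy_norm_lsc\<close>, where the norm is accessible only through comparison with a
  threshold.\<close>

lemma lower_semicontinuous_iff_eventually:
  "lower_semicontinuous F \<longleftrightarrow>
    (\<forall>x X. X \<longlonglongrightarrow> x \<longrightarrow> (\<forall>c<F x. \<forall>\<^sub>F n in sequentially. c < F (X n)))"
  unfolding lower_semicontinuous_def le_Liminf_iff by blast

text \<open>Transferred from extended reals, where nonnegativity, automatic here, excludes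
  \<infinity> - \<infinity>.\<close>

lemma liminf_add_le_ennreal:
  fixes f g :: "nat \<Rightarrow> ennreal"
  shows "liminf f + liminf g \<le> liminf (\<lambda>n. f n + g n)"
  including ennreal.lifting by transfer (rule Liminf_add_le; simp)

locale energy_functional =
  fixes F :: "'a::real_inner \<Rightarrow> ennreal"
  assumes symmetric: "symmetric_functional F"
    and convex: "convex_functional F"
    and lsc: "lower_semicontinuous F"
begin

lemma energy1_zero: "energy1 F 0 = 0"
  using symmetric by (simp add: energy1_def symmetric_functional_def)

lemma energy1_minus: "energy1 F (- x) = energy1 F x"
  using symmetric by (simp add: energy1_def symmetric_functional_def)

lemma energy1_convex:
  assumes "0 \<le> t" "t \<le> 1"
  shows "energy1 F ((1 - t) *\<^sub>R x + t *\<^sub>R y)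
    \<le> ennreal (1 - t) * energy1 F x + ennreal t * energy1 F y"
proof -
  \<comment> \<open>The inner product gives the exact convexity defect of the squared norm, which is
    then dropped as nonnegative.\<close>
  have "(norm ((1 - t) *\<^sub>R x + t *\<^sub>R y))\<^sup>2 = (1 - t) * (norm x)\<^sup>2 + t * (norm y)\<^sup>2
      - t * (1 - t) * (norm (x - y))\<^sup>2"
    by (simp add: power2_norm_eq_inner inner_commute algebra_simps)
  also have "\<dots> \<le> (1 - t) * (norm x)\<^sup>2 + t * (norm y)\<^sup>2"
    using assms by simp
  finally have n: "ennreal ((norm ((1 - t) *\<^sub>R x + t *\<^sub>R y))\<^sup>2)
      \<le> ennreal (1 - t) * ennreal ((norm x)\<^sup>2) + ennreal t * ennreal ((norm y)\<^sup>2)"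
    using assms by (simp add: ennreal_mult[symmetric] ennreal_plus[symmetric] ennreal_leI
        del: ennreal_plus)
  have "F ((1 - t) *\<^sub>R x + t *\<^sub>R y) \<le> ennreal (1 - t) * F x + ennreal t * F y"
    using convex assms by (simp add: convex_functional_def)
  from add_mono[OF n this] show ?thesis
    by (simp add: energy1_def distrib_left ac_simps)
qed

text \<open>Convexity on the segment from 0, where \<open>energy1 F\<close> vanishes. It makes the
  set of scales admissible in the infimum upward closed.\<close>

lemma energy1_scaleR_le:
  assumes "0 \<le> t" "t \<le> 1"
  shows "energy1 F (t *\<^sub>R x) \<le> energy1 F x"
proof -
  have "energy1 F (t *\<^sub>R x) \<le> ennreal t * energy1 F x"
    using energy1_convex[OF assms, of 0 x] by (simp add: energy1_zero)
  also have "\<dots> \<le> 1 * energy1 F x"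
    using assms by (intro mult_right_mono) auto
  finally show ?thesis by simp
qed

lemma energy1_lsc: "lower_semicontinuous (energy1 F)"
  unfolding lower_semicontinuous_def
proof (intro allI impI)
  fix x :: 'a and X assume X: "X \<longlonglongrightarrow> x"
  have "(\<lambda>n. ennreal ((norm (X n))\<^sup>2)) \<longlonglongrightarrow> ennreal ((norm x)\<^sup>2)"
    by (intro tendsto_intros tendsto_ennrealI X)
  then have "liminf (\<lambda>n. ennreal ((norm (X n))\<^sup>2)) = ennreal ((norm x)\<^sup>2)"
    by (simp add: lim_imp_Liminf)
  then have "energy1 F x \<le> liminf (\<lambda>n. ennreal ((norm (X n))\<^sup>2)) + liminf (\<lambda>n. F (X n))"
    unfolding energy1_def using lsc X by (simp add: lower_semicontinuous_def add_left_mono)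
  also have "\<dots> \<le> liminf (\<lambda>n. energy1 F (X n))"
    unfolding energy1_def by (rule liminf_add_le_ennreal)
  finally show "energy1 F x \<le> liminf (\<lambda>n. energy1 F (X n))" .
qed

section \<open>The energy norm and its sublevel sets\<close>

text \<open>Admissible scales form an upward closed set, and lower semicontinuity adds its left
  endpoint if that is positive.\<close>

lemma energy_norm_le_iff:
  assumes "l > 0"
  shows "energy_norm F x \<le> ennreal l \<longleftrightarrow> energy1 F (x /\<^sub>R l) \<le> 1"
proof
  assume "energy1 F (x /\<^sub>R l) \<le> 1"
  then show "energy_norm F x \<le> ennreal l"
    unfolding energy_norm_def using assms by (intro Inf_lower) auto
next
  assume le: "energy_norm F x \<le> ennreal l"
  have above: "energy1 F (x /\<^sub>R m) \<le> 1" if "m > l" for m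
  proof -
    have "energy_norm F x < ennreal m"
      using le that assms by (meson ennreal_lessI le_less_trans order.strict_trans)
    then obtain k where k: "k > 0" "energy1 F (x /\<^sub>R k) \<le> 1" "k < m"
      by (auto simp: energy_norm_def Inf_less_iff ennreal_less_iff)
    have "x /\<^sub>R m = (k / m) *\<^sub>R (x /\<^sub>R k)"
      using k by (simp add: field_simps)
    also have "energy1 F \<dots> \<le> energy1 F (x /\<^sub>R k)"
      using k by (intro energy1_scaleR_le) auto
    finally show ?thesis using k by simp
  qed
  \<comment> \<open>Scales decrease to \<open>l\<close>. With \<open>Suc n\<close> each one lies
    strictly above \<open>l\<close>, as \<open>above\<close> demands; at \<open>n = 0\<close> the
    term \<open>1 / n\<close> would be 0.\<close>
  have "(\<lambda>n. x /\<^sub>R (l + 1 / Suc n)) \<longlonglongrightarrow> x /\<^sub>R (l + 0)"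
    using assms by (intro tendsto_intros LIMSEQ_Suc lim_1_over_n) auto
  then have "energy1 F (x /\<^sub>R l) \<le> liminf (\<lambda>n. energy1 F (x /\<^sub>R (l + 1 / Suc n)))"
    using energy1_lsc by (simp add: lower_semicontinuous_def)
  also have "\<dots> \<le> liminf (\<lambda>n::nat. 1)"
    by (intro Liminf_mono always_eventually allI above) simp
  finally show "energy1 F (x /\<^sub>R l) \<le> 1" by (simp add: Liminf_const)
qed

text \<open>Gives definiteness of the energy norm, continuity of the embedding and the Hilbert limit
  of an energy-Cauchy sequence.\<close>

lemma norm_le_energy_norm: "ennreal (norm x) \<le> energy_norm F x"
proof -
  have "norm x \<le> l" if "l > 0" "energy1 F (x /\<^sub>R l) \<le> 1" for l
  proof -
    have "ennreal ((norm (x /\<^sub>R l))\<^sup>2) \<le> 1"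
      using that(2) unfolding energy1_def by (meson le_iff_add order_trans)
    then have "(norm (x /\<^sub>R l))\<^sup>2 \<le> 1\<^sup>2" by simp
    then have "norm (x /\<^sub>R l) \<le> 1" by (rule power2_le_imp_le) simp
    then show ?thesis using that(1) by (simp add: field_simps)
  qed
  then show ?thesis
    unfolding energy_norm_def by (intro Inf_greatest) auto
qed

lemma energy_norm_zero: "energy_norm F 0 = 0"
proof -
  have "energy_norm F 0 \<le> ennreal l" if "l > 0" for l
    using that by (simp add: energy_norm_le_iff energy1_zero)
  then have "energy_norm F 0 \<le> 0 + ennreal l" if "l > 0" for l
    using that by simp
  then have "energy_norm F 0 \<le> 0"
    by (rule ennreal_le_epsilon)
  then show ?thesis by simp
qed

lemma energy_norm_eq_0_iff: "energy_norm F x = 0 \<longleftrightarrow> x = 0"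
  using norm_le_energy_norm[of x] energy_norm_zero by (auto simp: ennreal_eq_0_iff)

lemma energy_norm_minus: "energy_norm F (- x) = energy_norm F x"
  by (simp add: energy_norm_def energy1_minus)

text \<open>The norm itself is an admissible scale; \<open>x \<noteq> 0\<close> makes it positive,
  so that \<open>energy_norm_le_iff\<close> applies.\<close>

lemma energy_norm_finite_cases:
  assumes "energy_norm F x < \<infinity>" "x \<noteq> 0"
  obtains r where "r > 0" "energy_norm F x = ennreal r" "energy1 F (x /\<^sub>R r) \<le> 1"
proof -
  obtain r where r: "r \<ge> 0" "energy_norm F x = ennreal r"
    using assms(1) by (cases "energy_norm F x") auto
  moreover have "r \<noteq> 0"
    using r assms(2) energy_norm_eq_0_iff[of x] by auto
  ultimately show thesis
    using that[of r] energy_norm_le_iff[of r x] by auto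
qed

text \<open>If \<open>r\<close> is admissible for \<open>x\<close>, then
  \<open>\<bar>a\<bar> * r\<close> is admissible for \<open>a *\<^sub>R x\<close>, symmetry
  absorbing the sign of \<open>a\<close>.\<close>

lemma energy_norm_scaleR_le: "a \<noteq> 0 \<Longrightarrow> energy_norm F (a *\<^sub>R x) \<le> ennreal \<bar>a\<bar> * energy_norm F x"
proof (cases "x = 0 \<or> energy_norm F x = \<infinity>")
  case True
  then show "a \<noteq> 0 \<Longrightarrow> ?thesis"
    by (auto simp: energy_norm_zero ennreal_mult_top)
next
  case False
  then obtain r where r: "r > 0" "energy_norm F x = ennreal r" "energy1 F (x /\<^sub>R r) \<le> 1"
    using energy_norm_finite_cases[of x] by (auto simp: less_top)
  assume a: "a \<noteq> 0"
  have "(a *\<^sub>R x) /\<^sub>R (\<bar>a\<bar> * r) = (if a > 0 then x /\<^sub>R r else - (x /\<^sub>R r))"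
    using a by (auto simp: field_simps)
  then have "energy1 F ((a *\<^sub>R x) /\<^sub>R (\<bar>a\<bar> * r)) \<le> 1"
    using r energy1_minus by (auto split: if_splits)
  then have "energy_norm F (a *\<^sub>R x) \<le> ennreal (\<bar>a\<bar> * r)"
    using a r by (subst energy_norm_le_iff) auto
  then show ?thesis using r by (simp add: ennreal_mult)
qed

lemma energy_norm_scaleR: "energy_norm F (a *\<^sub>R x) = ennreal \<bar>a\<bar> * energy_norm F x"
proof (cases "a = 0")
  case True
  \<comment> \<open>The convention \<open>0 * \<infinity> = 0\<close> covers vectors of infinite
    norm.\<close>
  then show ?thesis by (simp add: energy_norm_zero)
next
  case False
  \<comment> \<open>The reverse inequality is the one-sided bound for the factor
    \<open>inverse a\<close>.\<close>
  have "energy_norm F (inverse a *\<^sub>R (a *\<^sub>R x))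
      \<le> ennreal \<bar>inverse a\<bar> * energy_norm F (a *\<^sub>R x)"
    using False by (intro energy_norm_scaleR_le) auto
  then have "ennreal \<bar>a\<bar> * energy_norm F x
      \<le> ennreal \<bar>a\<bar> * (ennreal \<bar>inverse a\<bar> * energy_norm F (a *\<^sub>R x))"
    using False by (intro mult_left_mono) auto
  also have "\<dots> = ennreal (\<bar>a\<bar> * \<bar>inverse a\<bar>) * energy_norm F (a *\<^sub>R x)"
    by (simp add: ennreal_mult mult.assoc)
  also have "\<dots> = energy_norm F (a *\<^sub>R x)"
    using False by (simp add: abs_mult[symmetric])
  finally show ?thesis
    using energy_norm_scaleR_le[OF False, of x] by (intro antisym)
qed

lemma energy_norm_triangle: "energy_norm F (x + y) \<le> energy_norm F x + energy_norm F y"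
proof (cases "x = 0 \<or> y = 0 \<or> energy_norm F x = \<infinity> \<or> energy_norm F y = \<infinity>")
  case True
  then show ?thesis by auto
next
  case False
  obtain r where r: "r > 0" "energy_norm F x = ennreal r" "energy1 F (x /\<^sub>R r) \<le> 1"
    using False energy_norm_finite_cases[of x] by (auto simp: less_top)
  obtain s where s: "s > 0" "energy_norm F y = ennreal s" "energy1 F (y /\<^sub>R s) \<le> 1"
    using False energy_norm_finite_cases[of y] by (auto simp: less_top)
  \<comment> \<open>This weight makes \<open>(x + y) /\<^sub>R (r + s)\<close> a convex combination
    of the two normalised vectors.\<close>
  define t where "t = s / (r + s)"
  have t: "0 \<le> t" "t \<le> 1" "1 - t = r / (r + s)"
    using r s by (auto simp: t_def field_simps)
  have "(x + y) /\<^sub>R (r + s) = (1 - t) *\<^sub>R (x /\<^sub>R r) + t *\<^sub>R (y /\<^sub>R s)"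
  proof -
    have "inverse (r + s) = (1 - t) * inverse r" "inverse (r + s) = t * inverse s"
      unfolding t(3) unfolding t_def using r(1) s(1) by (simp_all add: divide_inverse)
    then show ?thesis by (simp only: scaleR_add_right scaleR_scaleR)
  qed
  also have "energy1 F \<dots> \<le> ennreal (1 - t) * energy1 F (x /\<^sub>R r) + ennreal t * energy1 F (y /\<^sub>R s)"
    by (rule energy1_convex[OF t(1,2)])
  also have "\<dots> \<le> ennreal (1 - t) * 1 + ennreal t * 1"
    using r s by (intro add_mono mult_left_mono) auto
  also have "\<dots> = 1"
    using t(1,2) by (simp flip: ennreal_plus)
  finally have "energy_norm F (x + y) \<le> ennreal (r + s)"
    using r s by (subst energy_norm_le_iff) auto
  then show ?thesis using r s by simp
qed

text \<open>For fixed \<open>l > 0\<close>, exceeding \<open>l\<close> in norm means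
  \<open>1 < energy1 F (x /\<^sub>R l)\<close>, a condition stable along sequences by
  \<open>energy1_lsc\<close>.\<close>

lemma energy_norm_lsc: "lower_semicontinuous (energy_norm F)"
  unfolding lower_semicontinuous_iff_eventually
proof (intro allI impI)
  fix x :: 'a and X and c assume X: "X \<longlonglongrightarrow> x" and "c < energy_norm F x"
  \<comment> \<open>The intermediate value is finite and positive even if \<open>c = 0\<close>, so
    it can serve as a scale.\<close>
  then obtain b where b: "c < b" "b < energy_norm F x"
    using dense by blast
  have "b \<noteq> top" "b \<noteq> 0"
    using b by auto
  then obtain l where l: "b = ennreal l" "l > 0"
    by (cases b) (auto simp: order_less_le)
  have "(\<lambda>n. X n /\<^sub>R l) \<longlonglongrightarrow> x /\<^sub>R l"
    by (intro tendsto_intros X)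
  moreover have "1 < energy1 F (x /\<^sub>R l)"
    using b l energy_norm_le_iff[of l x] by (auto simp: not_le)
  ultimately have "\<forall>\<^sub>F n in sequentially. 1 < energy1 F (X n /\<^sub>R l)"
    using energy1_lsc unfolding lower_semicontinuous_iff_eventually by blast
  then show "\<forall>\<^sub>F n in sequentially. c < energy_norm F (X n)"
  proof eventually_elim
    case (elim n)
    then have "ennreal l < energy_norm F (X n)"
      using l energy_norm_le_iff[of l "X n"] by (auto simp: not_le)
    then show ?case using b l by simp
  qed
qed

section \<open>The energy space as a metric space, and its embedding\<close>

lemma mem_energy_space_iff: "x \<in> energy_space F \<longleftrightarrow> energy_norm F x < \<infinity>"
  by (simp add: energy_space_eq_finite_norm symmetric convex)

lemma subspace_energy_space: "subspace (energy_space F)"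
proof (rule subspaceI)
  show "0 \<in> energy_space F"
    by (simp add: mem_energy_space_iff energy_norm_zero)
  fix x assume "x \<in> energy_space F"
  then show "c *\<^sub>R x \<in> energy_space F" for c
    by (simp add: mem_energy_space_iff energy_norm_scaleR ennreal_mult_less_top)
  fix y assume "y \<in> energy_space F"
  with \<open>x \<in> energy_space F\<close> have "energy_norm F x + energy_norm F y < \<infinity>"
    by (simp add: mem_energy_space_iff)
  then show "x + y \<in> energy_space F"
    unfolding mem_energy_space_iff using energy_norm_triangle by (rule le_less_trans[rotated])
qed

lemma norm_on_energy_space: "norm_on (energy_space F) (energy_norm F)"
  unfolding norm_on_def
  using subspace_energy_space
  by (simp add: mem_energy_space_iff energy_norm_eq_0_iff energy_norm_scaleR energy_norm_triangle)

sublocale energy: Metric_space "energy_space F" "norm_dist (energy_norm F)"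
  by (intro norm_on_norm_dist_metric norm_on_energy_space energy_norm_minus)

text \<open>Since \<open>enn2real\<close> sends \<infinity> to 0, finiteness of the difference is
  what allows passing back from the real metric to the norm.\<close>

lemma ennreal_norm_dist:
  assumes "x \<in> energy_space F" "y \<in> energy_space F"
  shows "ennreal (norm_dist (energy_norm F) x y) = energy_norm F (x - y)"
  using subspace_diff[OF subspace_energy_space assms]
  by (simp add: norm_dist_def mem_energy_space_iff)

lemma dist_le_norm_dist:
  assumes "x \<in> energy_space F" "y \<in> energy_space F"
  shows "dist x y \<le> norm_dist (energy_norm F) x y"
  using norm_le_energy_norm[of "x - y"] ennreal_norm_dist[OF assms]
  by (metis dist_norm energy.nonneg ennreal_le_iff)

lemma continuous_map_energy_inclusion: "continuous_map energy.mtopology euclidean (\<lambda>x. x)"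
  unfolding continuous_map_def
proof (intro conjI allI impI)
  fix U :: "'a set" assume "openin euclidean U"
  then have "open U" by simp
  then show "openin energy.mtopology {x \<in> topspace energy.mtopology. x \<in> U}"
    unfolding energy.openin_mtopology
  proof (intro conjI allI impI)
    fix x assume x: "x \<in> {x \<in> topspace energy.mtopology. x \<in> U}"
    then obtain e where e: "e > 0" "ball x e \<subseteq> U"
      using \<open>open U\<close> open_contains_ball by blast
    \<comment> \<open>The embedding is 1-Lipschitz, so the Hilbert radius works unchanged.\<close>
    have "energy.mball x e \<subseteq> {x \<in> topspace energy.mtopology. x \<in> U}"
      using e(2) dist_le_norm_dist by force
    then show "\<exists>r>0. energy.mball x r \<subseteq> {x \<in> topspace energy.mtopology. x \<in> U}"
      using e(1) by blast
  qed auto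
qed auto

end

section \<open>Completeness\<close>

text \<open>Stated outside the locale because the type must now be complete: the candidate limit is
  the limit in the Hilbert space.\<close>

lemma mcomplete_energy_space:
  fixes F :: "'a::{real_inner, complete_space} \<Rightarrow> ennreal"
  assumes "energy_functional F"
  shows "Metric_space.mcomplete (energy_space F) (norm_dist (energy_norm F))"
proof -
  interpret energy_functional F by (rule assms)
  show ?thesis
    unfolding energy.mcomplete_def
  proof (intro allI impI)
    fix X assume X: "energy.MCauchy X"
    then have mem: "X n \<in> energy_space F" for n
      by (auto simp: energy.MCauchy_def)
    have small: "\<exists>M. \<forall>m\<ge>M. \<forall>n\<ge>M. norm_dist (energy_norm F) (X m) (X n) < e" if "e > 0" for e
      using X that by (auto simp: energy.MCauchy_def)
    have "Cauchy X"
      unfolding Cauchy_def using small dist_le_norm_dist[OF mem mem] by (meson le_less_trans)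
    then obtain x where x: "X \<longlonglongrightarrow> x"
      using Cauchy_convergent convergent_def by blast
    \<comment> \<open>Phrased with the extended-valued norm because \<open>x\<close> is not yet
      known to lie in the energy space; the passage to the lower limit leaves only a non-strict
      bound.\<close>
    have lim: "\<exists>M. \<forall>m\<ge>M. energy_norm F (X m - x) \<le> ennreal e" if "e > 0" for e
    proof -
      obtain M where M: "\<And>m n. m \<ge> M \<Longrightarrow> n \<ge> M \<Longrightarrow> norm_dist (energy_norm F) (X m) (X n) < e"
        using small[OF \<open>e > 0\<close>] by blast
      have "energy_norm F (X m - x) \<le> ennreal e" if "m \<ge> M" for m
      proof -
        have "(\<lambda>n. X m - X n) \<longlonglongrightarrow> X m - x"
          by (intro tendsto_intros x)
        \<comment> \<open>Here \<open>m\<close> stays fixed while \<open>n\<close> tends to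
          infinity.\<close>
        then have "energy_norm F (X m - x) \<le> liminf (\<lambda>n. energy_norm F (X m - X n))"
          using energy_norm_lsc by (simp add: lower_semicontinuous_def)
        also have "\<dots> \<le> liminf (\<lambda>n::nat. ennreal e)"
        proof (rule Liminf_mono, rule eventually_sequentiallyI)
          show "energy_norm F (X m - X n) \<le> ennreal e" if "n \<ge> M" for n
            using M[OF \<open>m \<ge> M\<close> that] by (simp flip: ennreal_norm_dist[OF mem mem] add: ennreal_leI)
        qed
        finally show ?thesis by (simp add: Liminf_const)
      qed
      then show ?thesis by blast
    qed
    have "x \<in> energy_space F"
    proof -
      obtain m where "energy_norm F (X m - x) \<le> ennreal 1"
        using lim[of 1] by auto
      then have "X m - x \<in> energy_space F"
        by (simp add: mem_energy_space_iff le_less_trans)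
      \<comment> \<open>The limit is recovered as a difference of two members of the
        subspace.\<close>
      then have "X m - (X m - x) \<in> energy_space F"
        by (rule subspace_diff[OF subspace_energy_space mem])
      then show ?thesis by simp
    qed
    moreover have "\<exists>M. \<forall>m\<ge>M. X m \<in> energy_space F \<and> norm_dist (energy_norm F) (X m) x < e"
      if "e > 0" for e
    proof -
      \<comment> \<open>Halving \<open>e\<close> turns the non-strict bound of \<open>lim\<close>
        into a strict one.\<close>
      obtain M where M: "\<And>m. m \<ge> M \<Longrightarrow> energy_norm F (X m - x) \<le> ennreal (e / 2)"
        using lim[of "e / 2"] \<open>e > 0\<close> half_gt_zero by blast
      have "norm_dist (energy_norm F) (X m) x < e" if "m \<ge> M" for m
        using M[OF that] \<open>e > 0\<close> \<open>x \<in> energy_space F\<close> mem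
        by (simp add: ennreal_norm_dist[symmetric])
      then show ?thesis using mem by blast
    qed
    ultimately show "\<exists>x. limitin energy.mtopology X x sequentially"
      by (auto simp: energy.limitin_metric eventually_sequentially)
  qed
qed

theorem theorem2p2:
  fixes F :: "'a::{real_inner, complete_space} \<Rightarrow> ennreal"
  assumes "symmetric_functional F"
    and "convex_functional F"
    and "lower_semicontinuous F"
  shows "banach_space_on (energy_space F) (energy_norm F)
    \<and> continuous_map
        (Metric_space.mtopology (energy_space F) (norm_dist (energy_norm F))) euclidean (\<lambda>x. x)
    \<and> lower_semicontinuous (energy_norm F)"
proof -
  interpret energy_functional F
    using assms by unfold_locales
  show ?thesis
    using norm_on_energy_space mcomplete_energy_space[OF energy_functional_axioms]
      continuous_map_energy_inclusion energy_norm_lsc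
    by (simp add: banach_space_on_def)
qed

end
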